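(* Assume $\Bbbk$ is an algebraically closed field of characteristic $p>0$, let $\mathbb{G}_a=(\Bbbk,+)$, and for $n\ge1$ let $V_n=\Bbbk^3$ be the $\mathbb{G}_a$-module given by the representation $$\mathbb{G}_a\to\operatorname{GL}_3(\Bbbk),\qquad t\mapsto\begin{pmatrix}1&0&0\\-t&1&0\\-t^{p^n}&0&1\end{pmatrix}.$$ Write $\Bbbk[V_n]=\Bbbk[x_0,x_1,x_2]$, where $x_0,x_1,x_2$ is the basis of $V_n^*$ dual to the standard basis of $\Bbbk^3$. Then $$\Bbbk[V_n]^{\mathbb{G}_a}=\Bbbk[x_0,\;x_2x_0^{p^n-1}-x_1^{p^n}]\quad\text{and}\quad \delta(\mathbb{G}_a,V_n)=\sigma(\mathbb{G}_a,V_n)=p^n.$$ Consequently, $\delta(\mathbb{G}_a)=\sigma(\mathbb{G}_a)=\infty$.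
   Context: For a linear algebraic group $G$ over $\Bbbk$, a $G$-module is a finite-dimensional rational representation $V$ of $G$ over $\Bbbk$. $\Bbbk[V]\cong S(V^* )$ is the ring of polynomial functions on $V$, with $G$-action $(g\cdot f)(v)=f(g^{-1}v)$ and invariant ring $\Bbbk[V]^G$, graded by degree. $\Bbbk[V]^G_{\le d}$ is the set of invariants of degree at most $d$. For $S\subseteq \Bbbk[V]$, $S_+$ is the set of elements of $S$ with constant term zero. The nullcone $\mathcal{N}_{G,V}\subseteq V$ is the common zero set of $\Bbbk[V]^G_+$. A subset $S\subseteq\Bbbk[V]^G$ is a $\delta$-set (resp. $\sigma$-set) if for every $v\in V^G\setminus\mathcal{N}_{G,V}$ (resp. $v\in V\setminus\mathcal{N}_{G,V}$) there is $f\in S_+$ with $f(v)\neq 0$. Then $\delta(G,V)$ (resp. $\sigma(G,V)$) is the minimal $d\ge0$ such that $\Bbbk[V]^G_{\le d}$ is a $\delta$-set (resp. $\sigma$-set), and $\delta(G)$ (resp. $\sigma(G)$) is the supremum of $\delta(G,V)$ (resp. $\sigma(G,V)$) over all $G$-modules $V$ (equal to $\infty$ if unbounded). *)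

theory Defs
  imports
    "Jordan_Normal_Form.Matrix"
    "HOL-Algebra.Group"
    "HOL-Library.Poly_Mapping"
    "HOL-Library.Extended_Nat"
    "HOL-Computational_Algebra.Computational_Algebra"
begin

text \<open>A polynomial over \<open>'k\<close> in the variables \<open>x\<^sub>0, x\<^sub>1, \<dots>\<close> is a finitely supported map from
  exponent vectors to coefficients.\<close>

type_synonym 'k mpoly = "(nat \<Rightarrow>\<^sub>0 nat) \<Rightarrow>\<^sub>0 'k"

definition mvar :: "nat \<Rightarrow> 'k::comm_ring_1 mpoly" where
  "mvar i = Poly_Mapping.single (Poly_Mapping.single i 1) 1"

definition mconst :: "'k::comm_ring_1 \<Rightarrow> 'k mpoly" where
  "mconst c = Poly_Mapping.single 0 c"

definition meval :: "'k::comm_ring_1 mpoly \<Rightarrow> 'k vec \<Rightarrow> 'k" where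
  "meval f v = (\<Sum>e\<in>Poly_Mapping.keys f.
     Poly_Mapping.lookup f e * (\<Prod>i\<in>Poly_Mapping.keys e. (v $ i) ^ Poly_Mapping.lookup e i))"

definition mdegree_le :: "'k::zero mpoly \<Rightarrow> nat \<Rightarrow> bool" where
  "mdegree_le f d \<longleftrightarrow>
     (\<forall>e\<in>Poly_Mapping.keys f. (\<Sum>i\<in>Poly_Mapping.keys e. Poly_Mapping.lookup e i) \<le> d)"

text \<open>The coordinate ring of \<open>V = 'k\<^sup>m\<close>. Formal polynomials in \<open>m\<close> variables are identified with the
  polynomial functions on \<open>'k\<^sup>m\<close>; this is an isomorphism as soon as the field is infinite, in
  particular when it is algebraically closed.\<close>

definition coord_ring :: "nat \<Rightarrow> 'k::zero mpoly set" where
  "coord_ring m = {f. \<forall>e\<in>Poly_Mapping.keys f. Poly_Mapping.keys e \<subseteq> {..<m}}"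

definition plus_part :: "'k::zero mpoly set \<Rightarrow> 'k mpoly set" where
  "plus_part S = {f \<in> S. Poly_Mapping.lookup f 0 = 0}"

inductive_set generated_algebra :: "'k::comm_ring_1 mpoly set \<Rightarrow> 'k mpoly set"
  for S :: "'k mpoly set" where
  gen: "f \<in> S \<Longrightarrow> f \<in> generated_algebra S"
| const: "mconst c \<in> generated_algebra S"
| add: "f \<in> generated_algebra S \<Longrightarrow> g \<in> generated_algebra S \<Longrightarrow> f + g \<in> generated_algebra S"
| mult: "f \<in> generated_algebra S \<Longrightarrow> g \<in> generated_algebra S \<Longrightarrow> f * g \<in> generated_algebra S"


text \<open>An algebraic group is given by its group of \<open>'k\<close>-points together with its ring of regular
  functions. The latter enters only through the notion of a rational representation.\<close>

record ('g, 'k) alg_group = "'g monoid" +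
  regular :: "('g \<Rightarrow> 'k) set"

definition additive_group :: "('k::field, 'k) alg_group" where
  "additive_group = \<lparr>carrier = UNIV, mult = (+), one = 0, regular = range poly\<rparr>"

lemma group_additive_group: "group (additive_group :: ('k::field, 'k) alg_group)"
  by (rule groupI) (auto simp: additive_group_def intro: exI[of _ "- _"])

text \<open>A module \<open>(m, \<rho>)\<close> is the space \<open>carrier_vec m\<close> with the action \<open>g \<cdot> v = \<rho> g *\<^sub>v v\<close>; up to
  isomorphism every finite-dimensional rational representation is of this form.\<close>

definition gmodule ::
  "('g, 'k::field) alg_group \<Rightarrow> nat \<Rightarrow> ('g \<Rightarrow> 'k mat) \<Rightarrow> bool" where
  "gmodule G m \<rho> \<longleftrightarrow>
     (\<forall>g\<in>carrier G. \<rho> g \<in> carrier_mat m m) \<and>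
     \<rho> \<one>\<^bsub>G\<^esub> = 1\<^sub>m m \<and>
     (\<forall>g\<in>carrier G. \<forall>h\<in>carrier G. \<rho> (g \<otimes>\<^bsub>G\<^esub> h) = \<rho> g * \<rho> h) \<and>
     (\<forall>i<m. \<forall>j<m. \<exists>r\<in>regular G. \<forall>g\<in>carrier G. \<rho> g $$ (i, j) = r g)"

definition fixed_points ::
  "('g, 'k::field) alg_group \<Rightarrow> nat \<Rightarrow> ('g \<Rightarrow> 'k mat) \<Rightarrow> 'k vec set" where
  "fixed_points G m \<rho> = {v \<in> carrier_vec m. \<forall>g\<in>carrier G. \<rho> g *\<^sub>v v = v}"

definition invariants ::
  "('g, 'k::field) alg_group \<Rightarrow> nat \<Rightarrow> ('g \<Rightarrow> 'k mat) \<Rightarrow> 'k mpoly set" where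
  "invariants G m \<rho> = {f \<in> coord_ring m.
     \<forall>g\<in>carrier G. \<forall>v\<in>carrier_vec m. meval f (\<rho> (inv\<^bsub>G\<^esub> g) *\<^sub>v v) = meval f v}"

definition invariants_le ::
  "('g, 'k::field) alg_group \<Rightarrow> nat \<Rightarrow> ('g \<Rightarrow> 'k mat) \<Rightarrow> nat \<Rightarrow> 'k mpoly set" where
  "invariants_le G m \<rho> d = {f \<in> invariants G m \<rho>. mdegree_le f d}"

definition nullcone ::
  "('g, 'k::field) alg_group \<Rightarrow> nat \<Rightarrow> ('g \<Rightarrow> 'k mat) \<Rightarrow> 'k vec set" where
  "nullcone G m \<rho> = {v \<in> carrier_vec m. \<forall>f\<in>plus_part (invariants G m \<rho>). meval f v = 0}"

definition delta_set ::
  "('g, 'k::field) alg_group \<Rightarrow> nat \<Rightarrow> ('g \<Rightarrow> 'k mat) \<Rightarrow> 'k mpoly set \<Rightarrow> bool" where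
  "delta_set G m \<rho> S \<longleftrightarrow> S \<subseteq> invariants G m \<rho> \<and>
     (\<forall>v \<in> fixed_points G m \<rho> - nullcone G m \<rho>. \<exists>f\<in>plus_part S. meval f v \<noteq> 0)"

definition sigma_set ::
  "('g, 'k::field) alg_group \<Rightarrow> nat \<Rightarrow> ('g \<Rightarrow> 'k mat) \<Rightarrow> 'k mpoly set \<Rightarrow> bool" where
  "sigma_set G m \<rho> S \<longleftrightarrow> S \<subseteq> invariants G m \<rho> \<and>
     (\<forall>v \<in> carrier_vec m - nullcone G m \<rho>. \<exists>f\<in>plus_part S. meval f v \<noteq> 0)"

text \<open>The minima below exist: polynomial rings over a field are Noetherian, so finitely many
  invariants already cut out the nullcone.\<close>

definition delta_mod ::
  "('g, 'k::field) alg_group \<Rightarrow> nat \<Rightarrow> ('g \<Rightarrow> 'k mat) \<Rightarrow> nat" where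
  "delta_mod G m \<rho> = (LEAST d. delta_set G m \<rho> (invariants_le G m \<rho> d))"

definition sigma_mod ::
  "('g, 'k::field) alg_group \<Rightarrow> nat \<Rightarrow> ('g \<Rightarrow> 'k mat) \<Rightarrow> nat" where
  "sigma_mod G m \<rho> = (LEAST d. sigma_set G m \<rho> (invariants_le G m \<rho> d))"

definition delta_grp :: "('g, 'k::field) alg_group \<Rightarrow> enat" where
  "delta_grp G = (SUP (m, \<rho>)\<in>{(m, \<rho>). gmodule G m \<rho>}. enat (delta_mod G m \<rho>))"

definition sigma_grp :: "('g, 'k::field) alg_group \<Rightarrow> enat" where
  "sigma_grp G = (SUP (m, \<rho>)\<in>{(m, \<rho>). gmodule G m \<rho>}. enat (sigma_mod G m \<rho>))"


definition rho_V :: "nat \<Rightarrow> nat \<Rightarrow> 'k::field \<Rightarrow> 'k mat" where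
  "rho_V p n t = mat_of_rows_list 3
     [[1, 0, 0],
      [- t, 1, 0],
      [- (t ^ (p ^ n)), 0, 1]]"

lemma gmodule_rho_V:
  assumes "CHAR('k::field) = p" "p > 0"
  shows "gmodule (additive_group :: ('k, 'k) alg_group) 3 (rho_V p n)"
proof -
  have prime: "prime p"
    using assms prime_CHAR_semidom[where 'a = 'k] by simp
  have fd: "(s + t) ^ (p ^ n) = s ^ (p ^ n) + t ^ (p ^ n)" for s t :: 'k
    using freshmans_dream'[of "p ^ n" n s t] assms prime by simp
  have pos: "p ^ n > 0"
    using assms by simp
  have less3: "i < 3 \<longleftrightarrow> i = 0 \<or> i = 1 \<or> i = (2::nat)" for i
    by auto
  have car: "rho_V p n t \<in> carrier_mat 3 3" for t :: 'k
    by (simp add: rho_V_def mat_of_rows_list_def numeral_3_eq_3)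
  have one: "rho_V p n (0::'k) = 1\<^sub>m 3"
    by (rule eq_matI) (use pos in \<open>auto simp: rho_V_def mat_of_rows_list_def less3\<close>)
  have mult: "rho_V p n (s + t) = rho_V p n s * rho_V p n t" for s t :: 'k
  proof (rule eq_matI)
    fix i j
    assume "i < dim_row (rho_V p n s * rho_V p n t)" "j < dim_col (rho_V p n s * rho_V p n t)"
    then have "i < 3" "j < 3"
      using car[of s] car[of t] by auto
    then show "rho_V p n (s + t) $$ (i, j) = (rho_V p n s * rho_V p n t) $$ (i, j)"
      by (auto simp: rho_V_def mat_of_rows_list_def scalar_prod_def fd less3
          atLeast0LessThan lessThan_nat_numeral lessThan_Suc)
  qed (use car[of s] car[of t] car[of "s + t"] in auto)
  have reg: "\<exists>r\<in>range poly. \<forall>t. rho_V p n (t::'k) $$ (i, j) = r t" if ij: "i < 3" "j < 3" for i j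
  proof -
    have "\<exists>q. \<forall>t. rho_V p n (t::'k) $$ (i, j) = poly q t"
    proof -
      consider "i = j" | "i = 1" "j = 0" | "i = 2" "j = 0" | "i \<noteq> j" "j \<noteq> 0"
        using ij less3[of i] by metis
      then show ?thesis
      proof cases
        case 1
        then show ?thesis using ij
          by (intro exI[of _ 1]) (auto simp: rho_V_def mat_of_rows_list_def less3)
      next
        case 2
        then show ?thesis
          by (intro exI[of _ "- [:0, 1:]"]) (auto simp: rho_V_def mat_of_rows_list_def)
      next
        case 3
        then show ?thesis
          by (intro exI[of _ "- monom 1 (p ^ n)"])
            (auto simp: rho_V_def mat_of_rows_list_def poly_monom)
      next
        case 4
        then show ?thesis using ij
          by (intro exI[of _ 0]) (auto simp: rho_V_def mat_of_rows_list_def less3)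
      qed
    qed
    then show ?thesis by auto
  qed
  show ?thesis
    using car one mult reg by (simp add: gmodule_def additive_group_def)
qed

end

theory Submission
  imports Defs
begin

text \<open>Write \<open>q = p\<^sup>n\<close> and \<open>h = x\<^sub>2 x\<^sub>0\<^bsup>q - 1\<^esup> - x\<^sub>1\<^sup>q\<close>. Where \<open>x\<^sub>0 \<noteq> 0\<close>, every orbit meets the
  slice \<open>x\<^sub>1 = 0\<close> in a single point, so an invariant \<open>f\<close> satisfies \<open>x\<^sub>0\<^sup>M f \<in> k[x\<^sub>0, h]\<close> for some
  \<open>M\<close>. The factor \<open>x\<^sub>0\<close> can be cancelled: modulo \<open>x\<^sub>0\<close> an element of \<open>k[x\<^sub>0, h]\<close> is a polynomial in
  \<open>h\<close>, and \<open>h\<close> restricts to \<open>- x\<^sub>1\<^sup>q\<close>, which takes all values. On the line through the fixed point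
  \<open>(0, 1, 0)\<close>, invariants are polynomials in \<open>y\<^sup>q\<close>, hence constant if of degree less than \<open>q\<close>,
  whereas \<open>h\<close> does not vanish at that point. Conversely \<open>x\<^sub>0\<close> and \<open>h\<close>, both of degree at most \<open>q\<close>,
  already cut out the nullcone.\<close>

section \<open>Evaluation of formal polynomials as a ring homomorphism\<close>

lemma poly_mapping_sum_singles:
  fixes f :: "'a \<Rightarrow>\<^sub>0 'b::comm_monoid_add"
  shows "(\<Sum>e\<in>Poly_Mapping.keys f. Poly_Mapping.single e (Poly_Mapping.lookup f e)) = f"
  by (rule poly_mapping_eqI)
    (auto simp: lookup_sum lookup_single when_def in_keys_iff sum.delta)

definition monomial_eval :: "(nat \<Rightarrow>\<^sub>0 nat) \<Rightarrow> 'k::comm_ring_1 vec \<Rightarrow> 'k" where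
  "monomial_eval e v = (\<Prod>i\<in>Poly_Mapping.keys e. (v $ i) ^ Poly_Mapping.lookup e i)"

lemma monomial_eval_superset:
  assumes "finite A" "Poly_Mapping.keys e \<subseteq> A"
  shows "monomial_eval e v = (\<Prod>i\<in>A. (v $ i) ^ Poly_Mapping.lookup e i)"
  unfolding monomial_eval_def
  by (rule prod.mono_neutral_left) (use assms in \<open>auto simp: in_keys_iff\<close>)

lemma monomial_eval_0 [simp]: "monomial_eval 0 v = 1"
  by (simp add: monomial_eval_def)

lemma monomial_eval_single [simp]: "monomial_eval (Poly_Mapping.single i k) v = (v $ i) ^ k"
  by (simp add: monomial_eval_def)

lemma monomial_eval_add: "monomial_eval (e + e') v = monomial_eval e v * monomial_eval e' v"
proof -
  let ?A = "Poly_Mapping.keys e \<union> Poly_Mapping.keys e'"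
  have "finite ?A" by simp
  then show ?thesis
    using Poly_Mapping.keys_add[of e e']
    by (simp add: monomial_eval_superset[of ?A] lookup_add power_add prod.distrib)
qed

text \<open>Exponents outside the support have coefficient zero. Summing over a larger set allows
  polynomials with different supports to be compared over one index set.\<close>

lemma meval_superset:
  assumes "finite A" "Poly_Mapping.keys f \<subseteq> A"
  shows "meval f v = (\<Sum>e\<in>A. Poly_Mapping.lookup f e * monomial_eval e v)"
  unfolding meval_def monomial_eval_def
  by (rule sum.mono_neutral_left) (use assms in \<open>auto simp: in_keys_iff\<close>)

lemma meval_monomial_eval:
  "meval f v = (\<Sum>e\<in>Poly_Mapping.keys f. Poly_Mapping.lookup f e * monomial_eval e v)"
  by (rule meval_superset) auto

lemma meval_0 [simp]: "meval 0 v = 0"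
  by (simp add: meval_def)

lemma meval_single: "meval (Poly_Mapping.single e c) v = c * monomial_eval e v"
  by (subst meval_superset[of "{e}"]) auto

lemma meval_mconst [simp]: "meval (mconst c) v = c"
  by (simp add: mconst_def meval_single)

lemma meval_mvar [simp]: "meval (mvar i) v = v $ i"
  by (simp add: mvar_def meval_single)

lemma meval_1 [simp]: "meval 1 v = 1"
  using meval_mconst[of 1 v] by (simp add: mconst_def)

lemma meval_add [simp]: "meval (f + g) v = meval f v + meval g v"
proof -
  let ?A = "Poly_Mapping.keys f \<union> Poly_Mapping.keys g"
  have "finite ?A" by simp
  then show ?thesis
    using Poly_Mapping.keys_add[of f g]
    by (simp add: meval_superset[of ?A] lookup_add distrib_right sum.distrib)
qed

lemma meval_sum [simp]: "meval (\<Sum>i\<in>I. f i) v = (\<Sum>i\<in>I. meval (f i) v)"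
  by (induction I rule: infinite_finite_induct) auto

text \<open>Both factors are expanded into single terms, for which the claim is that exponents add,
  \<open>monomial_eval_add\<close>.\<close>

lemma meval_mult [simp]: "meval (f * g) v = meval f v * meval g v"
proof -
  let ?s = "\<lambda>h e. Poly_Mapping.single e (Poly_Mapping.lookup h e)"
  have "meval ((\<Sum>e\<in>Poly_Mapping.keys f. ?s f e) * (\<Sum>e\<in>Poly_Mapping.keys g. ?s g e)) v =
      (\<Sum>e\<in>Poly_Mapping.keys f. \<Sum>e'\<in>Poly_Mapping.keys g. meval (?s f e) v * meval (?s g e') v)"
    by (simp add: sum_product mult_single meval_single monomial_eval_add mult_ac)
  also have "\<dots> = meval (\<Sum>e\<in>Poly_Mapping.keys f. ?s f e) v *
      meval (\<Sum>e\<in>Poly_Mapping.keys g. ?s g e) v"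
    by (simp add: sum_product)
  finally show ?thesis
    by (simp only: poly_mapping_sum_singles)
qed

lemma meval_power [simp]: "meval (f ^ n) v = meval f v ^ n"
  by (induction n) auto

lemma meval_uminus [simp]: "meval (- f) v = - meval f v"
  by (metis add.right_inverse meval_0 meval_add minus_unique)

lemma meval_diff [simp]: "meval (f - g) v = meval f v - meval g v"
  using meval_add[of f "- g" v] by simp

section \<open>Closure properties of the coordinate ring\<close>

lemma coord_ring_add: "f \<in> coord_ring m \<Longrightarrow> g \<in> coord_ring m \<Longrightarrow> f + g \<in> coord_ring m"
  using Poly_Mapping.keys_add[of f g] by (auto simp: coord_ring_def)

lemma coord_ring_uminus: "f \<in> coord_ring m \<Longrightarrow> - f \<in> coord_ring m"
  by (auto simp: coord_ring_def in_keys_iff)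

lemma coord_ring_diff:
  fixes f g :: "'k::ab_group_add mpoly"
  shows "f \<in> coord_ring m \<Longrightarrow> g \<in> coord_ring m \<Longrightarrow> f - g \<in> coord_ring m"
  using coord_ring_add[OF _ coord_ring_uminus, of f m g] by simp

lemma coord_ring_mult: "f \<in> coord_ring m \<Longrightarrow> g \<in> coord_ring m \<Longrightarrow> f * g \<in> coord_ring m"
  unfolding coord_ring_def
proof (safe, goal_cases)
  case (1 e i)
  then obtain a b where ab: "e = a + b" "a \<in> Poly_Mapping.keys f" "b \<in> Poly_Mapping.keys g"
    using keys_mult[of f g] by blast
  then have "i \<in> Poly_Mapping.keys a \<union> Poly_Mapping.keys b"
    using 1 Poly_Mapping.keys_add[of a b] by blast
  then show ?case
    using 1 ab by auto
qed

lemma coord_ring_mconst: "mconst c \<in> coord_ring m"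
  by (simp add: coord_ring_def mconst_def)

lemma coord_ring_mvar: "i < m \<Longrightarrow> mvar i \<in> coord_ring m"
  by (simp add: coord_ring_def mvar_def)

lemma coord_ring_power: "f \<in> coord_ring m \<Longrightarrow> f ^ n \<in> coord_ring m"
proof (induction n)
  case 0
  then show ?case by (simp add: coord_ring_def)
qed (simp add: coord_ring_mult)

text \<open>A nonconstant monomial contains a variable of index below \<open>m\<close>, which
  vanishes at the origin. Membership in \<open>plus_part\<close> can thus be tested by
  evaluation.\<close>

lemma meval_zero_vec:
  assumes "f \<in> coord_ring m"
  shows "meval f (0\<^sub>v m) = Poly_Mapping.lookup f 0"
proof -
  have "monomial_eval e (0\<^sub>v m) = (0::'a)" if "e \<in> Poly_Mapping.keys f" "e \<noteq> 0" for e
  proof -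
    have "Poly_Mapping.keys e \<noteq> {}"
      using that by simp
    then obtain i where "i \<in> Poly_Mapping.keys e"
      by blast
    moreover have "i < m"
      using assms that \<open>i \<in> Poly_Mapping.keys e\<close> by (auto simp: coord_ring_def)
    ultimately have "((0\<^sub>v m :: 'a vec) $ i) ^ Poly_Mapping.lookup e i = 0"
      by (simp add: in_keys_iff power_0_left)
    then show ?thesis
      using \<open>i \<in> Poly_Mapping.keys e\<close> by (auto simp: monomial_eval_def intro!: prod_zero)
  qed
  then have "meval f (0\<^sub>v m) =
      (\<Sum>e\<in>Poly_Mapping.keys f. if e = 0 then Poly_Mapping.lookup f e else 0)"
    unfolding meval_monomial_eval by (intro sum.cong) auto
  also have "\<dots> = Poly_Mapping.lookup f 0"
    by (simp add: sum.delta in_keys_iff)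
  finally show ?thesis .
qed

section \<open>Formal polynomials versus polynomial functions over infinite fields\<close>

lemma infinite_UNIV_alg_closed_field: "infinite (UNIV :: 'k::alg_closed_field set)"
proof
  assume fin: "finite (UNIV :: 'k set)"
  \<comment> \<open>Euclid's trick: \<open>P\<close> vanishes on the whole field, so
    \<open>P + 1\<close> has positive degree but no root.\<close>
  define P where "P = (\<Prod>a\<in>(UNIV :: 'k set). [:- a, 1:])"
  have "degree P = card (UNIV :: 'k set)"
    unfolding P_def by (subst degree_prod_sum_eq) auto
  then have "degree (P + 1) > 0"
    using fin by (subst degree_add_eq_left) (auto simp: card_gt_0_iff)
  then obtain x where "poly (P + 1) x = 0"
    using alg_closed_imp_poly_has_root by blast
  moreover have "poly P x = 0"
    using fin by (auto simp: P_def poly_prod intro!: prod_zero)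
  ultimately show False by simp
qed

lemma poly_eq_0_if_infinite_roots:
  fixes P :: "'k::idom poly"
  assumes "infinite (UNIV :: 'k set)" "\<And>x. poly P x = 0"
  shows "P = 0"
  using poly_roots_finite[of P] assms by auto

text \<open>The lowest digit is the remainder modulo \<open>B\<close>; the others follow by
  induction after cancelling \<open>B\<close>.\<close>

lemma digits_unique:
  fixes a b :: "nat \<Rightarrow> nat"
  assumes "\<And>i. i < m \<Longrightarrow> a i < B" "\<And>i. i < m \<Longrightarrow> b i < B"
    and "(\<Sum>i<m. a i * B ^ i) = (\<Sum>i<m. b i * B ^ i)" "i < m"
  shows "a i = b i"
  using assms
proof (induction m arbitrary: a b i)
  case (Suc m)
  have eq: "a 0 + B * (\<Sum>i<m. a (Suc i) * B ^ i) = b 0 + B * (\<Sum>i<m. b (Suc i) * B ^ i)"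
    using Suc.prems(3) by (simp add: sum.lessThan_Suc_shift sum_distrib_left mult_ac del: sum.lessThan_Suc)
  have lt: "a 0 < B" "b 0 < B"
    using Suc.prems by auto
  have "a 0 = b 0"
    using arg_cong[OF eq, of "\<lambda>n. n mod B"] lt by simp
  moreover have "(\<Sum>i<m. a (Suc i) * B ^ i) = (\<Sum>i<m. b (Suc i) * B ^ i)"
    using eq \<open>a 0 = b 0\<close> lt by auto
  then have "a (Suc j) = b (Suc j)" if "j < m" for j
    using that by (intro Suc.IH[of "\<lambda>i. a (Suc i)" "\<lambda>i. b (Suc i)"]) (simp_all add: Suc.prems(1,2))
  ultimately show ?case
    using Suc.prems(4) by (cases i) simp_all
qed simp

lemma coord_ring_eq_0I:
  fixes f :: "'k::idom mpoly"
  assumes inf: "infinite (UNIV :: 'k set)" and f: "f \<in> coord_ring m"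
    and zero: "\<And>v. v \<in> carrier_vec m \<Longrightarrow> meval f v = 0"
  shows "f = 0"
proof (rule poly_mapping_eqI)
  \<comment> \<open>Kronecker substitution \<open>x\<^sub>i = t\<^bsup>B\<^sup>i\<^esup>\<close> with \<open>B\<close> larger than all exponents
    keeps distinct monomials distinct.\<close>
  define K where "K = Poly_Mapping.keys f"
  define B where "B = Suc (\<Sum>e\<in>K. \<Sum>i<m. Poly_Mapping.lookup e i)"
  define k where "k e = (\<Sum>i<m. Poly_Mapping.lookup e i * B ^ i)" for e :: "nat \<Rightarrow>\<^sub>0 nat"
  define P where "P = (\<Sum>e\<in>K. Polynomial.monom (Poly_Mapping.lookup f e) (k e))"
  have fin: "finite K"
    by (simp add: K_def)
  have keys: "Poly_Mapping.keys e \<subseteq> {..<m}" if "e \<in> K" for e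
    using f that by (auto simp: coord_ring_def K_def)
  have less: "Poly_Mapping.lookup e i < B" if "e \<in> K" "i < m" for e i
  proof -
    have "Poly_Mapping.lookup e i \<le> (\<Sum>i<m. Poly_Mapping.lookup e i)"
      using that by (intro member_le_sum) auto
    also have "\<dots> \<le> (\<Sum>e\<in>K. \<Sum>i<m. Poly_Mapping.lookup e i)"
      using that fin by (intro member_le_sum[of e K "\<lambda>e. \<Sum>i<m. Poly_Mapping.lookup e i"]) auto
    finally show ?thesis by (simp add: B_def)
  qed
  have inj: "inj_on k K"
  proof (rule inj_onI, rule poly_mapping_eqI)
    fix e e' i
    assume e: "e \<in> K" "e' \<in> K" "k e = k e'"
    show "Poly_Mapping.lookup e i = Poly_Mapping.lookup e' i"
    proof (cases "i < m")
      case True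
      then show ?thesis
        using digits_unique[of m "Poly_Mapping.lookup e" B "Poly_Mapping.lookup e'" i] e less
        by (simp add: k_def)
    next
      case False
      then have "i \<notin> Poly_Mapping.keys e" "i \<notin> Poly_Mapping.keys e'"
        using keys e by auto
      then show ?thesis by (simp add: in_keys_iff)
    qed
  qed
  have "poly P t = 0" for t
  proof -
    let ?v = "vec m (\<lambda>i. t ^ (B ^ i))"
    have "monomial_eval e ?v = t ^ k e" if "e \<in> K" for e
      using keys[OF that]
      by (simp add: monomial_eval_superset[of "{..<m}"] k_def power_sum mult.commute flip: power_mult)
    then have "meval f ?v = poly P t"
      by (simp add: meval_monomial_eval P_def poly_sum poly_monom flip: K_def)
    then show ?thesis using zero[of ?v] by simp
  qed
  then have P0: "P = 0"
    using inf poly_eq_0_if_infinite_roots by blast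
  fix e
  show "Poly_Mapping.lookup f e = Poly_Mapping.lookup 0 e"
  proof (cases "e \<in> K")
    case True
    \<comment> \<open>By injectivity of \<open>k\<close>, only the monomial \<open>e\<close>
      contributes to the coefficient at \<open>k e\<close>.\<close>
    have "0 = Polynomial.coeff P (k e)"
      by (simp add: P0)
    also have "\<dots> = (\<Sum>e'\<in>K. if e' = e then Poly_Mapping.lookup f e' else 0)"
      unfolding P_def Polynomial.coeff_sum
      using inj True by (intro sum.cong) (auto simp: inj_on_def)
    also have "\<dots> = Poly_Mapping.lookup f e"
      using fin True by simp
    finally show ?thesis by simp
  qed (simp add: K_def in_keys_iff)
qed

text \<open>This turns identities checked pointwise on \<open>carrier_vec m\<close> into identities
  of formal polynomials.\<close>

lemma coord_ring_eqI:
  fixes f g :: "'k::idom mpoly"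
  assumes "infinite (UNIV :: 'k set)" "f \<in> coord_ring m" "g \<in> coord_ring m"
    and "\<And>v. v \<in> carrier_vec m \<Longrightarrow> meval f v = meval g v"
  shows "f = g"
  using coord_ring_eq_0I[of "f - g" m] assms by (simp add: coord_ring_diff)

text \<open>At \<open>y \<cdot>\<^sub>v w\<close> a monomial takes its value at \<open>w\<close>
  times \<open>y\<close> to its total degree, so a bound on the total degree becomes a bound on a
  univariate degree.\<close>

lemma meval_line:
  fixes f :: "'k::idom mpoly"
  assumes f: "f \<in> coord_ring m" and d: "mdegree_le f d" and w: "w \<in> carrier_vec m"
  obtains R where "Polynomial.degree R \<le> d" "\<And>y. meval f (y \<cdot>\<^sub>v w) = poly R y"
proof
  let ?k = "\<lambda>e. \<Sum>i\<in>Poly_Mapping.keys e. Poly_Mapping.lookup e i"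
  let ?R = "\<Sum>e\<in>Poly_Mapping.keys f.
    Polynomial.monom (Poly_Mapping.lookup f e * monomial_eval e w) (?k e)"
  show "Polynomial.degree ?R \<le> d"
  proof (rule degree_sum_le)
    fix e
    assume "e \<in> Poly_Mapping.keys f"
    then show "Polynomial.degree (Polynomial.monom (Poly_Mapping.lookup f e * monomial_eval e w) (?k e)) \<le> d"
      using d by (auto simp: mdegree_le_def intro: order.trans[OF degree_monom_le])
  qed simp
  fix y
  have "monomial_eval e (y \<cdot>\<^sub>v w) = y ^ ?k e * monomial_eval e w" if "e \<in> Poly_Mapping.keys f" for e
  proof -
    have "i < dim_vec w" if "i \<in> Poly_Mapping.keys e" for i
      using f w \<open>e \<in> _\<close> that by (auto simp: coord_ring_def)
    then show ?thesis
      by (simp add: monomial_eval_def power_mult_distrib prod.distrib power_sum)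
  qed
  then show "meval f (y \<cdot>\<^sub>v w) = poly ?R y"
    by (simp add: meval_monomial_eval poly_sum poly_monom mult_ac)
qed

section \<open>Powers of variables and generated subalgebras\<close>

lemma mvar_power: "mvar i ^ k = Poly_Mapping.single (Poly_Mapping.single i k) 1"
  by (induction k) (simp_all add: mvar_def mult_single flip: single_add)

lemma generated_algebra_0: "0 \<in> generated_algebra S"
  using generated_algebra.const[of 0 S] by (simp add: mconst_def)

lemma generated_algebra_1: "1 \<in> generated_algebra S"
  using generated_algebra.const[of 1 S] by (simp add: mconst_def)

lemma generated_algebra_power: "f \<in> generated_algebra S \<Longrightarrow> f ^ n \<in> generated_algebra S"
  by (induction n) (auto intro: generated_algebra_1 generated_algebra.mult)

lemma generated_algebra_sum:
  "(\<And>i. i \<in> I \<Longrightarrow> f i \<in> generated_algebra S) \<Longrightarrow> (\<Sum>i\<in>I. f i) \<in> generated_algebra S"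
  by (induction I rule: infinite_finite_induct)
    (auto intro: generated_algebra_0 generated_algebra.add)

lemma generated_algebra_mono:
  assumes "f \<in> generated_algebra S" "S \<subseteq> T"
  shows "f \<in> generated_algebra T"
  using assms by (induction) (auto intro: generated_algebra.intros)

lemma generated_algebra_subset_coord_ring:
  assumes "S \<subseteq> coord_ring m"
  shows "generated_algebra S \<subseteq> coord_ring m"
proof
  fix f
  assume "f \<in> generated_algebra S"
  then show "f \<in> coord_ring m"
    using assms by induction (auto intro: coord_ring_mconst coord_ring_add coord_ring_mult)
qed

text \<open>Serves two purposes: for two points of one orbit it gives invariance, and for a point
  and the origin it shows which elements can separate them.\<close>

lemma generated_algebra_meval_cong:
  assumes "f \<in> generated_algebra S" "\<And>s. s \<in> S \<Longrightarrow> meval s v = meval s w"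
  shows "meval f v = meval f w"
  using assms by induction auto

text \<open>The functions on \<open>X\<close> that are polynomials in \<open>u\<close> form an
  algebra containing the constants, so only generators need checking.\<close>

lemma generated_algebra_meval_poly:
  assumes "f \<in> generated_algebra S"
    and "\<And>s. s \<in> S \<Longrightarrow> \<exists>r. \<forall>v\<in>X. meval s v = poly r (u v)"
  shows "\<exists>r. \<forall>v\<in>X. meval f v = poly r (u v)"
  using assms
proof induction
  case (const c)
  show ?case by (intro exI[of _ "[:c:]"]) simp
next
  case (add f g)
  then obtain r r' where "\<forall>v\<in>X. meval f v = poly r (u v)" "\<forall>v\<in>X. meval g v = poly r' (u v)"
    by blast
  then show ?case by (intro exI[of _ "r + r'"]) simp
next
  case (mult f g)
  then obtain r r' where "\<forall>v\<in>X. meval f v = poly r (u v)" "\<forall>v\<in>X. meval g v = poly r' (u v)"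
    by blast
  then show ?case by (intro exI[of _ "r * r'"]) simp
qed

text \<open>Reduction modulo \<open>x\<close>: the remainder \<open>r\<close> involves only the
  other generators. Only existence of the splitting is asserted.\<close>

lemma generated_algebra_insert_decompose:
  assumes "f \<in> generated_algebra (insert x S)"
  shows "\<exists>g\<in>generated_algebra (insert x S). \<exists>r\<in>generated_algebra S. f = x * g + r"
proof -
  have decompI: "\<exists>g\<in>generated_algebra (insert x S). \<exists>r\<in>generated_algebra S. f = x * g + r"
    if "g \<in> generated_algebra (insert x S)" "r \<in> generated_algebra S" "f = x * g + r" for f g r
    using that by blast
  show ?thesis
    using assms
  proof induction
    case (gen f)
    show ?case
    proof (cases "f = x")
      case True
      then show ?thesis
        by (intro decompI[of 1 0]) (auto intro: generated_algebra_0 generated_algebra_1)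
    next
      case False
      then show ?thesis
        using gen by (intro decompI[of 0 f]) (auto intro: generated_algebra_0 generated_algebra.gen)
    qed
  next
    case (const c)
    show ?case
      by (intro decompI[of 0 "mconst c"]) (auto intro: generated_algebra_0 generated_algebra.const)
  next
    case (add f f')
    then obtain g r g' r' where
      "g \<in> generated_algebra (insert x S)" "r \<in> generated_algebra S" "f = x * g + r"
      "g' \<in> generated_algebra (insert x S)" "r' \<in> generated_algebra S" "f' = x * g' + r'"
      by blast
    then show ?case
      by (intro decompI[of "g + g'" "r + r'"])
        (auto intro: generated_algebra.add simp: algebra_simps)
  next
    case (mult f f')
    then obtain g r g' r' where
      *: "g \<in> generated_algebra (insert x S)" "r \<in> generated_algebra S" "f = x * g + r"
      "g' \<in> generated_algebra (insert x S)" "r' \<in> generated_algebra S" "f' = x * g' + r'"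
      by blast
    \<comment> \<open>The quotient of the product contains the mixed term \<open>r * g'\<close>, so
      \<open>r\<close> has to be viewed in the larger algebra.\<close>
    then have "r \<in> generated_algebra (insert x S)"
      by (auto intro: generated_algebra_mono)
    with * mult.hyps have "g * f' + r * g' \<in> generated_algebra (insert x S)"
      by (intro generated_algebra.add generated_algebra.mult)
    moreover have "f * f' = x * (g * f' + r * g') + r * r'"
      by (simp add: * algebra_simps)
    ultimately show ?case
      using * by (intro decompI[of "g * f' + r * g'" "r * r'"] generated_algebra.mult)
  qed
qed

section \<open>The three-dimensional module in coordinates\<close>

definition vec3 :: "'a \<Rightarrow> 'a \<Rightarrow> 'a \<Rightarrow> 'a vec" where
  "vec3 x y z = vec 3 (\<lambda>i. [x, y, z] ! i)"

lemma dim_vec3 [simp]: "dim_vec (vec3 x y z) = 3"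
  by (simp add: vec3_def)

lemma vec3_carrier [simp]: "vec3 x y z \<in> carrier_vec 3"
  by (simp add: carrier_vecI)

lemma vec3_index [simp]: "vec3 x y z $ 0 = x" "vec3 x y z $ Suc 0 = y" "vec3 x y z $ 2 = z"
  by (simp_all add: vec3_def)

lemma less_3_cases: "i < (3::nat) \<longleftrightarrow> i = 0 \<or> i = Suc 0 \<or> i = 2"
  by auto

lemma vec3_eta: "v \<in> carrier_vec 3 \<Longrightarrow> v = vec3 (v $ 0) (v $ Suc 0) (v $ 2)"
  by (rule eq_vecI) (auto simp: less_3_cases)

lemma carrier_vec_3_iff: "v \<in> carrier_vec 3 \<longleftrightarrow> (\<exists>x y z. v = vec3 x y z)"
  using vec3_eta vec3_carrier by metis

lemma ball_carrier_vec_3: "(\<forall>v\<in>carrier_vec 3. P v) \<longleftrightarrow> (\<forall>x y z. P (vec3 x y z))"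
  unfolding Ball_def carrier_vec_3_iff by blast

lemma rho_V_mult_vec3:
  "rho_V p n t *\<^sub>v vec3 x y z = vec3 x (y - t * x) (z - t ^ (p ^ n) * x)"
  by (rule eq_vecI)
    (auto simp: rho_V_def mat_of_rows_list_def scalar_prod_def less_3_cases
      atLeast0LessThan lessThan_nat_numeral lessThan_Suc)

lemma inv_additive_group [simp]: "inv\<^bsub>additive_group\<^esub> t = - (t :: 'k::field)"
  by (rule group.inv_equality[OF group_additive_group]) (auto simp: additive_group_def)

lemma carrier_additive_group [simp]: "carrier additive_group = UNIV"
  by (simp add: additive_group_def)

text \<open>Since \<open>t\<close> ranges over the whole group, the inverse in the definition of
  \<open>invariants\<close> disappears under \<open>t \<mapsto> - t\<close>.\<close>

lemma invariants_rho_V_iff: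
  fixes f :: "'k::field mpoly"
  shows "f \<in> invariants additive_group 3 (rho_V p n) \<longleftrightarrow> f \<in> coord_ring 3 \<and>
    (\<forall>t x y z. meval f (vec3 x (y - t * x) (z - t ^ (p ^ n) * x)) = meval f (vec3 x y z))"
proof -
  have "(\<forall>t. P (- t)) \<longleftrightarrow> (\<forall>t. P t)" for P :: "'k \<Rightarrow> bool"
    by (metis minus_minus)
  from this[of "\<lambda>t. \<forall>v\<in>carrier_vec 3. meval f (rho_V p n t *\<^sub>v v) = meval f v"] show ?thesis
    unfolding invariants_def by (simp add: ball_carrier_vec_3 rho_V_mult_vec3)
qed

section \<open>Additivity of Frobenius and the two basic invariants\<close>

lemma frobenius_power_diff:
  fixes s t :: "'k::field"
  assumes "CHAR('k) = p" "p > 0"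
  shows "(s - t) ^ (p ^ n) = s ^ (p ^ n) - t ^ (p ^ n)"
proof -
  have "prime p"
    using assms prime_CHAR_semidom[where 'a = 'k] by simp
  \<comment> \<open>Additivity of the Frobenius power is applied to
    \<open>(s - t) + t\<close>.\<close>
  then show ?thesis
    using freshmans_dream'[of "p ^ n" n "s - t" t] assms by simp
qed

text \<open>Divided by \<open>x\<^sub>0 ^ (q - 1)\<close>, this is the last coordinate of the point
  where an orbit with \<open>x\<^sub>0 \<noteq> 0\<close> meets the slice.\<close>

definition frobenius_invariant :: "nat \<Rightarrow> 'k::comm_ring_1 mpoly" where
  "frobenius_invariant q = mvar 2 * mvar 0 ^ (q - 1) - mvar 1 ^ q"

lemma meval_frobenius_invariant:
  "meval (frobenius_invariant q) v = v $ 2 * (v $ 0) ^ (q - 1) - (v $ 1) ^ q"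
  by (simp add: frobenius_invariant_def)

lemma frobenius_invariant_coord_ring: "frobenius_invariant q \<in> coord_ring 3"
  unfolding frobenius_invariant_def
  by (intro coord_ring_diff coord_ring_mult coord_ring_power coord_ring_mvar) auto

lemma generated_algebra_coord_ring_3:
  "f \<in> generated_algebra {mvar 0, frobenius_invariant q} \<Longrightarrow> f \<in> coord_ring 3"
  using generated_algebra_subset_coord_ring[of "{mvar 0, frobenius_invariant q}" 3]
  by (auto simp: frobenius_invariant_coord_ring coord_ring_mvar)

text \<open>Acting by \<open>t\<close> lowers both \<open>z * x ^ (q - 1)\<close> and
  \<open>y ^ q\<close>, where \<open>q = p ^ n\<close>, by \<open>t ^ q * x ^ q\<close>, the latter
  by Frobenius, so their difference is unchanged.\<close>

lemma generated_algebra_subset_invariants: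
  fixes f :: "'k::field mpoly"
  assumes "CHAR('k) = p" "p > 0"
    and f: "f \<in> generated_algebra {mvar 0, frobenius_invariant (p ^ n)}"
  shows "f \<in> invariants additive_group 3 (rho_V p n)"
  unfolding invariants_rho_V_iff
proof (intro conjI allI)
  show "f \<in> coord_ring 3"
    using f by (rule generated_algebra_coord_ring_3)
  fix t x y z :: 'k
  have "x ^ (p ^ n) = x * x ^ (p ^ n - 1)"
    using assms by (metis power_minus_mult mult.commute zero_less_power)
  then show "meval f (vec3 x (y - t * x) (z - t ^ (p ^ n) * x)) = meval f (vec3 x y z)"
    by (intro generated_algebra_meval_cong[OF f])
      (auto simp: meval_frobenius_invariant frobenius_power_diff[OF assms(1,2)]
        power_mult_distrib algebra_simps)
qed

text \<open>In \<open>mvar 0 * f = mvar 0 * g + r\<close> the remainder is \<open>P\<close>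
  evaluated at the second generator. It is shown to vanish, and \<open>mvar 0\<close> is then
  cancelled in an integral domain.\<close>

lemma generated_algebra_cancel_mvar_0:
  fixes f :: "'k::alg_closed_field mpoly"
  assumes q: "q > 0" and f: "f \<in> coord_ring 3"
    and "mvar 0 * f \<in> generated_algebra {mvar 0, frobenius_invariant q}"
  shows "f \<in> generated_algebra {mvar 0, frobenius_invariant q}"
proof -
  obtain g r where g: "g \<in> generated_algebra {mvar 0, frobenius_invariant q}"
    and r: "r \<in> generated_algebra {frobenius_invariant q}" and eq: "mvar 0 * f = mvar 0 * g + r"
    using generated_algebra_insert_decompose[OF assms(3)] by blast
  have "\<exists>P. \<forall>v\<in>UNIV. meval r v = poly P (meval (frobenius_invariant q) v)"
    by (rule generated_algebra_meval_poly[OF r]) (auto intro!: exI[of _ "[:0, 1:]"])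
  then obtain P where P: "\<And>v. meval r v = poly P (meval (frobenius_invariant q) v)"
    by blast
  have "poly P u = 0" for u
  proof -
    \<comment> \<open>At \<open>vec3 0 y 0\<close> the second generator equals
      \<open>- (y ^ q)\<close>, so this root makes it take the value \<open>u\<close>.\<close>
    obtain y where y: "y ^ q = - u"
      using nth_root_exists[OF q] by blast
    have "meval r (vec3 0 y 0) = 0"
      using arg_cong[OF eq, of "\<lambda>f. meval f (vec3 0 y 0)"] by simp
    then show ?thesis
      using P[of "vec3 0 y 0"] y by (simp add: meval_frobenius_invariant)
  qed
  then have "P = 0"
    using infinite_UNIV_alg_closed_field poly_eq_0_if_infinite_roots by blast
  moreover have "r \<in> coord_ring 3"
    using generated_algebra_coord_ring_3 generated_algebra_mono[OF r] by blast
  ultimately have "r = 0"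
    using infinite_UNIV_alg_closed_field P by (intro coord_ring_eq_0I[of r 3]) auto
  moreover have "(mvar 0 :: 'k mpoly) \<noteq> 0"
    by (metis mvar_def lookup_single_eq lookup_zero zero_neq_one)
  ultimately have "f = g"
    using eq by simp
  then show ?thesis
    using g by simp
qed

section \<open>Localization at the first coordinate and the invariant ring\<close>

lemma meval_vec3:
  assumes "f \<in> coord_ring 3"
  shows "meval f (vec3 x y z) = (\<Sum>e\<in>Poly_Mapping.keys f. Poly_Mapping.lookup f e *
    (x ^ Poly_Mapping.lookup e 0 * y ^ Poly_Mapping.lookup e 1 * z ^ Poly_Mapping.lookup e 2))"
  unfolding meval_monomial_eval
proof (intro sum.cong refl arg_cong2[of _ _ _ _ "(*)"])
  fix e
  assume "e \<in> Poly_Mapping.keys f"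
  then have "Poly_Mapping.keys e \<subseteq> {..<3}"
    using assms by (auto simp: coord_ring_def)
  then show "monomial_eval e (vec3 x y z) =
      x ^ Poly_Mapping.lookup e 0 * y ^ Poly_Mapping.lookup e 1 * z ^ Poly_Mapping.lookup e 2"
    by (subst monomial_eval_superset[of "{..<3}"])
      (auto simp: lessThan_nat_numeral lessThan_Suc mult_ac)
qed

text \<open>An invariant is determined away from \<open>x\<^sub>0 = 0\<close> by its values on the
  slice; a power of \<open>x\<^sub>0\<close> clears the denominators in the slice
  coordinate.\<close>

lemma invariant_localized:
  fixes f :: "'k::field mpoly"
  assumes inf: "infinite (UNIV :: 'k set)" and p: "p > 0"
    and f: "f \<in> invariants additive_group 3 (rho_V p n)"
  shows "\<exists>M. mvar 0 ^ M * f \<in> generated_algebra {mvar 0, frobenius_invariant (p ^ n)}"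
proof -
  define q where "q = p ^ n"
  let ?h = "frobenius_invariant q :: 'k mpoly"
  let ?A = "generated_algebra {mvar 0, ?h}"
  define K where "K = Poly_Mapping.keys f"
  \<comment> \<open>Any common bound for the exponents of \<open>x\<^sub>2\<close> would do; the sum
    is a convenient one.\<close>
  define N where "N = (\<Sum>e\<in>K. Poly_Mapping.lookup e 2)"
  \<comment> \<open>This is \<open>f\<close> at
    \<open>(x\<^sub>0, 0, h / x\<^sub>0 ^ (q - 1))\<close>, multiplied by
    \<open>x\<^sub>0 ^ ((q - 1) * N)\<close>. As \<open>0 ^ 0 = 1\<close>, the power of zero keeps
    exactly the terms free of \<open>x\<^sub>1\<close>.\<close>
  define P where "P = (\<Sum>e\<in>K. mconst (Poly_Mapping.lookup f e * 0 ^ Poly_Mapping.lookup e 1) *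
    mvar 0 ^ (Poly_Mapping.lookup e 0 + (q - 1) * (N - Poly_Mapping.lookup e 2)) *
    ?h ^ Poly_Mapping.lookup e 2)"
  have q: "q > 0"
    using p by (simp add: q_def)
  have coord: "f \<in> coord_ring 3"
    using f by (simp add: invariants_rho_V_iff)
  have "P \<in> ?A"
    unfolding P_def
    by (intro generated_algebra_sum generated_algebra.mult generated_algebra_power
        generated_algebra.const generated_algebra.gen) auto
  then have A: "mvar 0 * P \<in> ?A"
    by (auto intro: generated_algebra.mult generated_algebra.gen)
  have le: "Poly_Mapping.lookup e 2 \<le> N" if "e \<in> K" for e
    unfolding N_def using that by (intro member_le_sum) (auto simp: K_def)
  \<comment> \<open>The extra factor \<open>mvar 0\<close> makes both sides vanish where
    \<open>x = 0\<close>, a locus the slice does not control.\<close>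
  have "mvar 0 ^ Suc ((q - 1) * N) * f = mvar 0 * P"
  proof (rule coord_ring_eqI[OF inf])
    show "mvar 0 ^ Suc ((q - 1) * N) * f \<in> coord_ring 3"
      using coord by (intro coord_ring_mult coord_ring_power coord_ring_mvar) auto
    show "mvar 0 * P \<in> coord_ring 3"
      using A by (rule generated_algebra_coord_ring_3)
    fix v :: "'k vec"
    assume "v \<in> carrier_vec 3"
    then obtain x y z where v: "v = vec3 x y z"
      by (auto simp: carrier_vec_3_iff)
    show "meval (mvar 0 ^ Suc ((q - 1) * N) * f) v = meval (mvar 0 * P) v"
    proof (cases "x = 0")
      case True
      then show ?thesis by (simp add: v)
    next
      case False
      define H where "H = z * x ^ (q - 1) - y ^ q"
      define w where "w = H / x ^ (q - 1)"
      have "x ^ q = x * x ^ (q - 1)"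
        using q by (metis power_minus_mult mult.commute)
      \<comment> \<open>The group element \<open>y / x\<close> moves \<open>vec3 x y z\<close> to
        \<open>vec3 x 0 w\<close>.\<close>
      then have "z - (y / x) ^ q * x = w"
        using False by (simp add: w_def H_def power_divide field_simps)
      then have slice: "meval f v = meval f (vec3 x 0 w)"
        using f False unfolding invariants_rho_V_iff q_def[symmetric] v
        by (metis diff_self nonzero_eq_divide_eq)
      have "x ^ ((q - 1) * N) * w ^ k = x ^ ((q - 1) * (N - k)) * H ^ k" if "k \<le> N" for k
      proof -
        have "x ^ ((q - 1) * N) = x ^ ((q - 1) * (N - k)) * (x ^ (q - 1)) ^ k"
          using that by (simp flip: power_mult power_add distrib_left)
        then show ?thesis
          using False by (simp add: w_def power_divide)
      qed
      then have "x ^ ((q - 1) * N) * meval f (vec3 x 0 w) = meval P v"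
        unfolding meval_vec3[OF coord] P_def K_def[symmetric] v sum_distrib_left meval_sum
        using le
        by (intro sum.cong) (simp_all add: meval_frobenius_invariant H_def power_add mult_ac)
      then show ?thesis
        unfolding meval_mult meval_power meval_mvar slice by (simp add: v)
    qed
  qed
  then show ?thesis
    using A unfolding q_def by metis
qed

text \<open>Localization puts \<open>mvar 0 ^ M * f\<close> into the algebra; the factors
  \<open>mvar 0\<close> are then cancelled one at a time.\<close>

lemma invariants_rho_V:
  assumes "CHAR('k::alg_closed_field) = p" "p > 0"
  shows "invariants (additive_group :: ('k, 'k) alg_group) 3 (rho_V p n) =
    generated_algebra {mvar 0, frobenius_invariant (p ^ n)}"
proof (intro equalityI subsetI)
  fix f :: "'k mpoly"
  assume f: "f \<in> invariants additive_group 3 (rho_V p n)"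
  then have coord: "f \<in> coord_ring 3"
    by (simp add: invariants_rho_V_iff)
  obtain M where "mvar 0 ^ M * f \<in> generated_algebra {mvar 0, frobenius_invariant (p ^ n)}"
    using invariant_localized[OF infinite_UNIV_alg_closed_field assms(2) f] by blast
  then show "f \<in> generated_algebra {mvar 0, frobenius_invariant (p ^ n)}"
  proof (induction M)
    case (Suc M)
    have "mvar 0 ^ M * f \<in> coord_ring 3"
      using coord by (intro coord_ring_mult coord_ring_power coord_ring_mvar) auto
    then have "mvar 0 ^ M * f \<in> generated_algebra {mvar 0, frobenius_invariant (p ^ n)}"
      using generated_algebra_cancel_mvar_0[of "p ^ n" "mvar 0 ^ M * f"] Suc.prems assms(2)
      by (simp add: mult.assoc)
    then show ?case by (rule Suc.IH)
  qed simp
qed (rule generated_algebra_subset_invariants[OF assms])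

section \<open>Degrees of the generators and the values of delta and sigma\<close>

lemma degree_monomial_add:
  fixes e e' :: "nat \<Rightarrow>\<^sub>0 nat"
  shows "(\<Sum>i\<in>Poly_Mapping.keys (e + e'). Poly_Mapping.lookup (e + e') i) =
    (\<Sum>i\<in>Poly_Mapping.keys e. Poly_Mapping.lookup e i) +
    (\<Sum>i\<in>Poly_Mapping.keys e'. Poly_Mapping.lookup e' i)"
proof -
  let ?A = "Poly_Mapping.keys e \<union> Poly_Mapping.keys e'"
  have *: "(\<Sum>i\<in>Poly_Mapping.keys d. Poly_Mapping.lookup d i) = (\<Sum>i\<in>?A. Poly_Mapping.lookup d i)"
    if "Poly_Mapping.keys d \<subseteq> ?A" for d
    using that by (intro sum.mono_neutral_left) (auto simp: in_keys_iff)
  show ?thesis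
    by (subst (1 2 3) *) (use Poly_Mapping.keys_add[of e e'] in \<open>auto simp: lookup_add sum.distrib\<close>)
qed

text \<open>Both monomials have total degree \<open>q\<close>; for the first,
  \<open>1 + (q - 1) = q\<close> uses \<open>q > 0\<close>.\<close>

lemma mdegree_le_frobenius_invariant:
  assumes "q > 0"
  shows "mdegree_le (frobenius_invariant q :: 'k::comm_ring_1 mpoly) q"
proof -
  let ?s = "\<lambda>e. Poly_Mapping.single e (1::'k)"
  let ?e = "Poly_Mapping.single 2 1 + Poly_Mapping.single 0 (q - 1) :: nat \<Rightarrow>\<^sub>0 nat"
  let ?e' = "Poly_Mapping.single 1 q :: nat \<Rightarrow>\<^sub>0 nat"
  have "frobenius_invariant q = ?s ?e + - ?s ?e'"
    by (simp add: frobenius_invariant_def mvar_power mult_single mvar_def[of 2])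
  then have "Poly_Mapping.keys (frobenius_invariant q :: 'k mpoly) \<subseteq> {?e, ?e'}"
    by (auto simp: in_keys_iff lookup_minus lookup_single when_def split: if_splits)
  moreover have "(\<Sum>i\<in>Poly_Mapping.keys ?e. Poly_Mapping.lookup ?e i) \<le> q"
    using assms unfolding degree_monomial_add by simp
  ultimately show ?thesis
    by (fastforce simp: mdegree_le_def)
qed

lemma mdegree_le_mvar: "q > 0 \<Longrightarrow> mdegree_le (mvar i) q"
  by (simp add: mdegree_le_def mvar_def)

lemma low_degree_vanishes:
  fixes f :: "'k::field mpoly"
  assumes inf: "infinite (UNIV :: 'k set)"
    and f: "f \<in> generated_algebra {mvar 0, frobenius_invariant q}"
    and d: "mdegree_le f d" "d < q" and const: "Poly_Mapping.lookup f 0 = 0"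
  shows "meval f (vec3 0 1 0) = 0"
proof -
  have coord: "f \<in> coord_ring 3"
    using f by (rule generated_algebra_coord_ring_3)
  obtain R where R: "Polynomial.degree R \<le> d" "\<And>y. meval f (y \<cdot>\<^sub>v vec3 0 1 0) = poly R y"
    using meval_line[OF coord d(1), of "vec3 0 1 0"] by auto
  have line: "y \<cdot>\<^sub>v vec3 0 1 0 = vec3 0 y 0" for y :: 'k
    by (rule eq_vecI) (auto simp: less_3_cases)
  have "\<exists>r. \<forall>v\<in>range (\<lambda>y. vec3 0 y 0). meval f v = poly r ((v $ 1) ^ q)"
  proof (rule generated_algebra_meval_poly[OF f])
    fix s :: "'k mpoly"
    assume "s \<in> {mvar 0, frobenius_invariant q}"
    then consider "s = mvar 0" | "s = frobenius_invariant q" by blast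
    then show "\<exists>r. \<forall>v\<in>range (\<lambda>y. vec3 0 y 0). meval s v = poly r ((v $ 1) ^ q)"
    proof cases
      case 1
      then show ?thesis by (intro exI[of _ 0]) auto
    next
      case 2
      then show ?thesis
        by (intro exI[of _ "[:0, - 1:]"]) (auto simp: meval_frobenius_invariant)
    qed
  qed
  then obtain r where r: "\<And>y. meval f (vec3 0 y 0) = poly r (y ^ q)"
    by auto
  \<comment> \<open>Two descriptions of \<open>f\<close> on the line are compared: \<open>R\<close>
    has degree at most \<open>d\<close>, while a nonconstant polynomial in \<open>y ^ q\<close> has
    degree at least \<open>q\<close>.\<close>
  have "R - pcompose r (Polynomial.monom 1 q) = 0"
    using R(2) r by (intro poly_eq_0_if_infinite_roots[OF inf]) (simp add: poly_pcompose poly_monom line)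
  then have "Polynomial.degree r * q \<le> d"
    using R(1) by (simp add: degree_pcompose degree_monom_eq)
  then have "Polynomial.degree r = 0"
    using d(2) by (cases "Polynomial.degree r") auto
  then obtain c where "r = [:c:]"
    by (rule degree_eq_zeroE)
  then have "meval f (vec3 0 1 0) = meval f (vec3 0 0 0)"
    by (simp add: r)
  also have "vec3 0 0 0 = (0\<^sub>v 3 :: 'k vec)"
    by (rule eq_vecI) (auto simp: less_3_cases)
  finally show ?thesis
    by (simp add: meval_zero_vec[OF coord] const)
qed

text \<open>Supplies separating invariants for the upper bound, and the one that keeps
  \<open>vec3 0 1 0\<close> out of the nullcone.\<close>

lemma generators_plus_part_invariants_le:
  assumes "CHAR('k::field) = p" "p > 0"
    and "s \<in> {mvar 0, frobenius_invariant (p ^ n)}"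
  shows "s \<in> plus_part (invariants_le (additive_group :: ('k, 'k) alg_group) 3 (rho_V p n) (p ^ n))"
proof -
  have "s \<in> generated_algebra {mvar 0, frobenius_invariant (p ^ n)}"
    using assms(3) by (rule generated_algebra.gen)
  moreover have "mdegree_le s (p ^ n)"
    using assms(2,3) mdegree_le_mvar[of "p ^ n" 0] mdegree_le_frobenius_invariant[of "p ^ n"] by auto
  moreover have "Poly_Mapping.lookup s 0 = meval s (0\<^sub>v 3)"
    using generated_algebra_coord_ring_3[OF calculation(1)] by (simp add: meval_zero_vec)
  ultimately show ?thesis
    using assms generated_algebra_subset_invariants[OF assms(1,2)]
    by (auto simp: plus_part_def invariants_le_def meval_frobenius_invariant power_0_left)
qed

lemma sigma_set_rho_V:
  assumes "CHAR('k::alg_closed_field) = p" "p > 0"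
  shows "sigma_set (additive_group :: ('k, 'k) alg_group) 3 (rho_V p n)
    (invariants_le additive_group 3 (rho_V p n) (p ^ n))"
  unfolding sigma_set_def
proof (intro conjI ballI)
  let ?G = "additive_group :: ('k, 'k) alg_group"
  fix v :: "'k vec"
  assume v: "v \<in> carrier_vec 3 - nullcone ?G 3 (rho_V p n)"
  then obtain f where f: "f \<in> plus_part (invariants ?G 3 (rho_V p n))" and fv: "meval f v \<noteq> 0"
    by (auto simp: nullcone_def)
  have gen: "f \<in> generated_algebra {mvar 0, frobenius_invariant (p ^ n)}"
    using f unfolding plus_part_def invariants_rho_V[OF assms] by simp
  have "meval f (0\<^sub>v 3) = 0"
    using f meval_zero_vec[OF generated_algebra_coord_ring_3[OF gen]] by (simp add: plus_part_def)
  \<comment> \<open>If both generators agreed at \<open>v\<close> and at the origin, so would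
    \<open>f\<close>, but \<open>f\<close> vanishes only at the latter of the two.\<close>
  then obtain s where s: "s \<in> {mvar 0, frobenius_invariant (p ^ n)}" "meval s v \<noteq> meval s (0\<^sub>v 3)"
    using generated_algebra_meval_cong[OF gen, of v "0\<^sub>v 3"] fv by metis
  then have "meval s v \<noteq> 0"
    using assms by (auto simp: meval_frobenius_invariant power_0_left)
  then show "\<exists>f\<in>plus_part (invariants_le ?G 3 (rho_V p n) (p ^ n)). meval f v \<noteq> 0"
    using generators_plus_part_invariants_le[OF assms s(1)] by blast
qed (simp add: invariants_le_def)

text \<open>The witness \<open>vec3 0 1 0\<close> is fixed because its first coordinate is zero. The
  second generator takes the value \<open>-1\<close> there, whereas invariants of degree below
  \<open>p ^ n\<close> without constant term vanish.\<close>

lemma not_delta_set_rho_V: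
  assumes "CHAR('k::alg_closed_field) = p" "p > 0" "d < p ^ n"
  shows "\<not> delta_set (additive_group :: ('k, 'k) alg_group) 3 (rho_V p n)
    (invariants_le additive_group 3 (rho_V p n) d)"
proof
  let ?G = "additive_group :: ('k, 'k) alg_group" and ?v = "vec3 0 1 0 :: 'k vec"
  assume delta: "delta_set ?G 3 (rho_V p n) (invariants_le ?G 3 (rho_V p n) d)"
  have "?v \<in> fixed_points ?G 3 (rho_V p n)"
    by (simp add: fixed_points_def rho_V_mult_vec3)
  moreover have "?v \<notin> nullcone ?G 3 (rho_V p n)"
  proof -
    have "frobenius_invariant (p ^ n) \<in> plus_part (invariants ?G 3 (rho_V p n))"
      using generators_plus_part_invariants_le[OF assms(1,2), of "frobenius_invariant (p ^ n)" n]
      by (simp add: plus_part_def invariants_le_def)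
    moreover have "meval (frobenius_invariant (p ^ n)) ?v \<noteq> 0"
      by (simp add: meval_frobenius_invariant)
    ultimately show ?thesis
      unfolding nullcone_def by blast
  qed
  ultimately obtain f where
    "f \<in> plus_part (invariants_le ?G 3 (rho_V p n) d)" "meval f ?v \<noteq> 0"
    using delta unfolding delta_set_def by blast
  then show False
    using low_degree_vanishes[OF infinite_UNIV_alg_closed_field, of f "p ^ n" d] assms
    by (simp add: plus_part_def invariants_le_def invariants_rho_V[OF assms(1,2)])
qed

text \<open>Fixed points are vectors of the module. Hence an upper bound for sigma and a lower bound
  for delta determine both numbers.\<close>

lemma sigma_set_imp_delta_set: "sigma_set G m \<rho> S \<Longrightarrow> delta_set G m \<rho> S"
  by (auto simp: sigma_set_def delta_set_def fixed_points_def)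

lemma delta_mod_rho_V:
  assumes "CHAR('k::alg_closed_field) = p" "p > 0"
  shows "delta_mod (additive_group :: ('k, 'k) alg_group) 3 (rho_V p n) = p ^ n"
  unfolding delta_mod_def
  using sigma_set_imp_delta_set[OF sigma_set_rho_V[OF assms]] not_delta_set_rho_V[OF assms]
  by (intro Least_equality) (auto simp: not_less[symmetric])

lemma sigma_mod_rho_V:
  assumes "CHAR('k::alg_closed_field) = p" "p > 0"
  shows "sigma_mod (additive_group :: ('k, 'k) alg_group) 3 (rho_V p n) = p ^ n"
  unfolding sigma_mod_def
  using sigma_set_rho_V[OF assms] not_delta_set_rho_V[OF assms]
  by (intro Least_equality) (auto simp: not_less[symmetric] dest: sigma_set_imp_delta_set)

section \<open>Unboundedness over all modules\<close>

lemma enat_eq_infinityI: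
  assumes "\<And>n. enat (p ^ n) \<le> x" "p > 1"
  shows "x = \<infinity>"
proof (cases x)
  case (enat k)
  \<comment> \<open>The bound is used with the supposed finite value \<open>k\<close> itself as
    exponent.\<close>
  then have "p ^ k \<le> k"
    using assms(1)[of k] by simp
  moreover have "k < p ^ k"
    using assms(2) by (simp add: power_gt_expt)
  ultimately show ?thesis by simp
qed

theorem proposition4p4:
  fixes p :: nat
  assumes "CHAR('k::alg_closed_field) = p" and "p > 0"
  shows "(\<forall>n\<ge>1.
            invariants (additive_group :: ('k, 'k) alg_group) 3 (rho_V p n) =
              generated_algebra
                {mvar 0, mvar 2 * mvar 0 ^ (p ^ n - 1) - mvar 1 ^ (p ^ n)} \<and>
            delta_mod (additive_group :: ('k, 'k) alg_group) 3 (rho_V p n) = p ^ n \<and>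
            sigma_mod (additive_group :: ('k, 'k) alg_group) 3 (rho_V p n) = p ^ n) \<and>
         delta_grp (additive_group :: ('k, 'k) alg_group) = \<infinity> \<and>
         sigma_grp (additive_group :: ('k, 'k) alg_group) = \<infinity>"
proof (intro conjI allI impI)
  let ?G = "additive_group :: ('k, 'k) alg_group"
  \<comment> \<open>A positive characteristic is prime, so the powers \<open>p ^ n\<close> are
    unbounded.\<close>
  have p: "p > 1"
    using assms prime_CHAR_semidom[where 'a = 'k] prime_gt_1_nat by blast
  have mem: "(3, rho_V p n) \<in> {(m, \<rho>). gmodule ?G m \<rho>}" for n
    using gmodule_rho_V[OF assms] by simp
  have "enat (p ^ n) \<le> delta_grp ?G" for n
    unfolding delta_grp_def by (rule SUP_upper2[OF mem[of n]]) (simp add: delta_mod_rho_V[OF assms])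
  then show "delta_grp ?G = \<infinity>"
    using p by (rule enat_eq_infinityI)
  have "enat (p ^ n) \<le> sigma_grp ?G" for n
    unfolding sigma_grp_def by (rule SUP_upper2[OF mem[of n]]) (simp add: sigma_mod_rho_V[OF assms])
  then show "sigma_grp ?G = \<infinity>"
    using p by (rule enat_eq_infinityI)
  fix n
  show "invariants ?G 3 (rho_V p n) =
      generated_algebra {mvar 0, mvar 2 * mvar 0 ^ (p ^ n - 1) - mvar 1 ^ (p ^ n)}"
    using invariants_rho_V[OF assms] by (simp add: frobenius_invariant_def)
qed (simp_all add: delta_mod_rho_V[OF assms] sigma_mod_rho_V[OF assms])

end
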